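(* Let $\alpha,n\in\mathbb{N}$ with $\alpha\geq 2$ and $n\geq 2\alpha+3+(\alpha\bmod 2)$, and let $k$ be a positive integer. Then: (1) if $\frac{2}{\alpha}k+4\leq n<\frac{2}{\alpha-1}k+3$, then $\gamma_{\times k}(K(n,2))=k+2\alpha$; (2) if $n=\left\lceil\frac{2}{\alpha}k\right\rceil+3$, then $\gamma_{\times k}(K(n,2))=k+2\alpha+1$.
   Context: The Kneser graph $K(n,2)$ has as vertices the $2$-subsets of $[n]=\{1,\dots,n\}$, two vertices adjacent iff disjoint. For a vertex $v$, $N[v]$ is its closed neighbourhood. A set $D$ of vertices is a $k$-tuple dominating set if $|N[v]\cap D|\geq k$ for every vertex $v$; $\gamma_{\times k}(K(n,2))$ is the minimum cardinality of such a set. *)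

theory Defs
  imports Complex_Main "HOL-Library.Extended_Nat" "Graph_Theory.Pair_Digraph"
begin

text \<open>Undirected simple graphs are represented as in the Graph Theory library: by vertices and
  a symmetric, irreflexive set of arcs (locale \<open>pair_graph\<close>).\<close>

definition kneser_graph :: "nat \<Rightarrow> nat \<Rightarrow> nat set pair_pre_digraph" where
  "kneser_graph n r =
    \<lparr> pverts = {A. A \<subseteq> {1..n} \<and> card A = r},
      parcs = {(A, B). A \<subseteq> {1..n} \<and> card A = r \<and> B \<subseteq> {1..n} \<and> card B = r \<and> A \<inter> B = {}} \<rparr>"

definition closed_neighbourhood :: "'a pair_pre_digraph \<Rightarrow> 'a \<Rightarrow> 'a set" where
  "closed_neighbourhood G v = insert v {w. (v, w) \<in> parcs G}"

text \<open>The next two definitions are intended for finite graphs only, where \<open>card\<close> is meaningful.\<close>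

definition k_tuple_dominating_set :: "nat \<Rightarrow> 'a pair_pre_digraph \<Rightarrow> 'a set \<Rightarrow> bool" where
  "k_tuple_dominating_set k G D \<longleftrightarrow>
    D \<subseteq> pverts G \<and> (\<forall>v\<in>pverts G. k \<le> card (closed_neighbourhood G v \<inter> D))"

text \<open>The values are extended naturals, so that the number is \<open>\<infinity>\<close> if there is no
  \<open>k\<close>-tuple dominating set. A finite value is attained, i.e. it is a minimum.\<close>

definition k_tuple_domination_number :: "nat \<Rightarrow> 'a pair_pre_digraph \<Rightarrow> enat" where
  "k_tuple_domination_number k G =
    (INF D\<in>{D. k_tuple_dominating_set k G D}. enat (card D))"

lemma pair_graph_kneser_graph:
  assumes "r > 0"
  shows "pair_graph (kneser_graph n r)"
proof -
  let ?G = "kneser_graph n r"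
  have fin: "finite (pverts ?G)"
    by (rule finite_subset[of _ "Pow {1..n}"]) (auto simp: kneser_graph_def)
  have arc: "(A, B) \<in> parcs ?G \<longleftrightarrow> A \<in> pverts ?G \<and> B \<in> pverts ?G \<and> A \<inter> B = {}" for A B
    by (simp add: kneser_graph_def)
  have nonempty: "A \<noteq> {}" if "A \<in> pverts ?G" for A
    using that assms by (force simp: kneser_graph_def)
  have subset: "parcs ?G \<subseteq> pverts ?G \<times> pverts ?G"
    using arc by (intro subrelI) blast
  show ?thesis
  proof unfold_locales
    show "finite (parcs ?G)"
      using subset fin finite_subset by blast
    show "symmetric (with_proj ?G)"
      unfolding symmetric_def with_proj_simps
    proof (rule symI)
      fix A B
      assume "(A, B) \<in> parcs ?G"
      then show "(B, A) \<in> parcs ?G"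
        unfolding arc by blast
    qed
    show "fst e \<in> pverts ?G" "snd e \<in> pverts ?G" if "e \<in> parcs ?G" for e
      using subsetD[OF subset that] by (simp_all add: mem_Times_iff)
    show "fst e \<noteq> snd e" if "e \<in> parcs ?G" for e
    proof -
      have "(fst e, snd e) \<in> parcs ?G" using that by simp
      then show ?thesis using nonempty unfolding arc by fastforce
    qed
  qed (rule fin)
qed

lemma k_tuple_domination_number_eq_enat_iff:
  "k_tuple_domination_number k G = enat m \<longleftrightarrow>
    (\<exists>D. k_tuple_dominating_set k G D \<and> card D = m) \<and>
    (\<forall>D. k_tuple_dominating_set k G D \<longrightarrow> m \<le> card D)"
    (is "?L \<longleftrightarrow> ?R")
proof
  let ?S = "(\<lambda>D. enat (card D)) ` {D. k_tuple_dominating_set k G D}"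
  assume L: ?L
  then have inf: "Inf ?S = enat m"
    by (simp add: k_tuple_domination_number_def)
  have "?S \<noteq> {}"
  proof
    assume "?S = {}"
    then show False using inf by (simp add: top_enat_def)
  qed
  then have "Inf ?S \<in> ?S" by (metis wellorder_InfI ex_in_conv)
  then have 1: "\<exists>D. k_tuple_dominating_set k G D \<and> card D = m"
    using inf by auto
  have "m \<le> card D" if "k_tuple_dominating_set k G D" for D
  proof -
    have "Inf ?S \<le> enat (card D)" using that by (intro Inf_lower) auto
    then show ?thesis using inf by simp
  qed
  with 1 show ?R by blast
next
  assume ?R
  then obtain D where D: "k_tuple_dominating_set k G D" "card D = m"
    and min: "\<And>D. k_tuple_dominating_set k G D \<Longrightarrow> m \<le> card D" by blast
  show ?L unfolding k_tuple_domination_number_def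
  proof (rule antisym)
    show "(INF D\<in>{D. k_tuple_dominating_set k G D}. enat (card D)) \<le> enat m"
      using D by (intro INF_lower2[of D]) auto
    show "enat m \<le> (INF D\<in>{D. k_tuple_dominating_set k G D}. enat (card D))"
      using min by (intro INF_greatest) auto
  qed
qed

end

theory Submission
  imports Defs
begin

text \<open>
  A set \<open>D\<close> of vertices of \<open>K(n,2)\<close> is the edge set of a graph on \<open>[n]\<close>, and it is \<open>k\<close>-tuple
  dominating iff \<open>d(a) + d(b) \<le> |D| - k + 2[ab \<in> D]\<close> for all \<open>a \<noteq> b\<close>, where \<open>d\<close> is the degree.
  Removing an edge preserves the bound on \<open>d(a) + d(b)\<close> for a fixed value of \<open>|D| - k\<close>.
  For the upper bounds take a graph with all degrees at most \<open>\<alpha>\<close> in part (1), and a subgraph of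
  the disjoint union of \<open>K\<^sub>\<alpha>\<^sub>+\<^sub>2\<close> and such a graph in part (2). For the lower bounds, suppose
  that \<open>|D| = k + t\<close> with \<open>t = 2\<alpha> - 1\<close> and \<open>t = 2\<alpha>\<close>, respectively. Summing the condition
  for a fixed \<open>a\<close> over all \<open>b\<close> gives \<open>2|D| \<le> (n - 1)t - (n - 4)d(a)\<close>, which contradicts the
  lower bound on \<open>|D|\<close> if \<open>d(a) > \<alpha>\<close> (in part (2) with \<open>\<alpha>\<close> even and \<open>n = 2\<alpha> + 3\<close>, only
  by parity). So all degrees are at most \<open>\<alpha>\<close>, which settles part (2); in part (1) the vertices
  of degree \<open>\<alpha>\<close> form a clique, so there are at most \<open>\<alpha> + 1\<close> of them.
\<close>

section \<open>Graphs as sets of pairs: degrees, neighbours, double counting\<close>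

definition pairs :: "'a set \<Rightarrow> 'a set set" where
  "pairs V = {e. e \<subseteq> V \<and> card e = 2}"

definition deg :: "'a set set \<Rightarrow> 'a \<Rightarrow> nat" where
  "deg E v = card {e \<in> E. v \<in> e}"

definition nbrs :: "'a set set \<Rightarrow> 'a \<Rightarrow> 'a set" where
  "nbrs E v = {w. w \<noteq> v \<and> {v, w} \<in> E}"

definition pair_degrees_le :: "nat \<Rightarrow> 'a set \<Rightarrow> 'a set set \<Rightarrow> bool" where
  "pair_degrees_le t V E \<longleftrightarrow>
    (\<forall>a\<in>V. \<forall>b\<in>V. a \<noteq> b \<longrightarrow> deg E a + deg E b \<le> t + 2 * of_bool ({a, b} \<in> E))"

lemma doubleton_in_pairs [simp]: "{a, b} \<in> pairs V \<longleftrightarrow> a \<in> V \<and> b \<in> V \<and> a \<noteq> b"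
  by (cases "a = b") (auto simp: pairs_def)

lemma pairsE:
  assumes "e \<in> pairs V"
  obtains a b where "e = {a, b}" "a \<in> V" "b \<in> V" "a \<noteq> b"
  using assms unfolding pairs_def by (auto simp: card_2_iff)

lemma pairs_mono: "V \<subseteq> W \<Longrightarrow> pairs V \<subseteq> pairs W"
  by (auto simp: pairs_def)

lemma finite_pairs: "finite V \<Longrightarrow> finite (pairs V)"
  by (rule finite_subset[of _ "Pow V"]) (auto simp: pairs_def)

lemma card_pairs: "finite V \<Longrightarrow> card (pairs V) = card V choose 2"
  unfolding pairs_def by (rule n_subsets)

lemma deg_insert:
  assumes "finite E" "e \<notin> E"
  shows "deg (insert e E) v = deg E v + of_bool (v \<in> e)"
proof -
  have "{f \<in> insert e E. v \<in> f} = (if v \<in> e then insert e {f \<in> E. v \<in> f} else {f \<in> E. v \<in> f})"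
    by auto
  then show ?thesis using assms by (simp add: deg_def)
qed

lemma deg_remove:
  assumes "finite E" "e \<in> E"
  shows "deg (E - {e}) v + of_bool (v \<in> e) = deg E v"
  using deg_insert[of "E - {e}" e v] assms by (simp add: insert_absorb)

lemma deg_mono: "finite E \<Longrightarrow> F \<subseteq> E \<Longrightarrow> deg F v \<le> deg E v"
  unfolding deg_def by (rule card_mono) auto

lemma deg_Un: "finite E \<Longrightarrow> finite F \<Longrightarrow> deg (E \<union> F) v \<le> deg E v + deg F v"
proof -
  have "{e \<in> E \<union> F. v \<in> e} = {e \<in> E. v \<in> e} \<union> {e \<in> F. v \<in> e}" by auto
  then show ?thesis unfolding deg_def by (metis card_Un_le)
qed

lemma deg_eq_0: "E \<subseteq> pairs V \<Longrightarrow> v \<notin> V \<Longrightarrow> deg E v = 0"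
proof -
  assume "E \<subseteq> pairs V" "v \<notin> V"
  then have "{e \<in> E. v \<in> e} = {}" by (auto simp: pairs_def)
  then show ?thesis by (metis card.empty deg_def)
qed

lemma card_nbrs:
  assumes "E \<subseteq> pairs V"
  shows "card (nbrs E v) = deg E v"
proof -
  have "{e \<in> E. v \<in> e} = (\<lambda>w. {v, w}) ` nbrs E v"
  proof (intro equalityI subsetI)
    fix e assume e: "e \<in> {e \<in> E. v \<in> e}"
    then have "e \<in> pairs V" using assms by auto
    then obtain a b where "e = {a, b}" "a \<noteq> b" by (rule pairsE)
    then show "e \<in> (\<lambda>w. {v, w}) ` nbrs E v"
      using e by (auto simp: nbrs_def insert_commute)
  qed (auto simp: nbrs_def)
  moreover have "inj_on (\<lambda>w. {v, w}) (nbrs E v)"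
    by (auto simp: inj_on_def doubleton_eq_iff)
  ultimately show ?thesis by (simp add: deg_def card_image)
qed

lemma nbrs_subset: "E \<subseteq> pairs V \<Longrightarrow> nbrs E v \<subseteq> V"
  by (auto simp: nbrs_def)

lemma handshake:
  assumes "finite V" "E \<subseteq> pairs V"
  shows "(\<Sum>v\<in>V. deg E v) = 2 * card E"
proof -
  have fin: "finite E" using assms finite_pairs finite_subset by blast
  have "(\<Sum>v\<in>V. deg E v) = (\<Sum>v\<in>V. \<Sum>e\<in>E. of_bool (v \<in> e))"
    using fin by (simp add: deg_def Int_def)
  also have "\<dots> = (\<Sum>e\<in>E. \<Sum>v\<in>V. of_bool (v \<in> e))" by (rule sum.swap)
  also have "\<dots> = (\<Sum>e\<in>E. 2)"
  proof (rule sum.cong)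
    fix e assume "e \<in> E"
    then have "e \<subseteq> V" "card e = 2" using assms by (auto simp: pairs_def)
    then show "(\<Sum>v\<in>V. of_bool (v \<in> e)) = (2::nat)"
      using assms by (simp add: Int_absorb1)
  qed simp
  finally show ?thesis by simp
qed

section \<open>Graphs with bounded degrees and a prescribed number of edges\<close>

text \<open>
  Induction on \<open>m\<close>. If two distinct vertices of degree less than \<open>r\<close> are not adjacent, join
  them. Otherwise choose \<open>u, v\<close> that can take one more edge each (\<open>u = v\<close> if \<open>u\<close> can take
  two), a vertex \<open>x\<close> not adjacent to \<open>u\<close>, and a neighbour \<open>y\<close> of \<open>x\<close> not adjacent to
  \<open>v\<close>, and replace the edge \<open>xy\<close> by \<open>ux\<close> and \<open>vy\<close>.
\<close>

lemma exists_graph_bounded_degree: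
  assumes V: "finite V" and r: "r < card V" and m: "2 * m \<le> r * card V"
  shows "\<exists>E. E \<subseteq> pairs V \<and> card E = m \<and> (\<forall>v. deg E v \<le> r)"
  using m
proof (induction m)
  case 0
  show ?case by (rule exI[of _ "{}"]) (simp add: deg_def)
next
  case (Suc m)
  then obtain E where E: "E \<subseteq> pairs V" "card E = m" "\<And>v. deg E v \<le> r" by auto
  have fin: "finite E" using E V finite_pairs finite_subset by blast
  have finN: "finite (nbrs E w)" for w using nbrs_subset[OF E(1)] V finite_subset by blast
  show ?case
  proof (cases "\<exists>u\<in>V. \<exists>v\<in>V. u \<noteq> v \<and> deg E u < r \<and> deg E v < r \<and> {u, v} \<notin> E")
    case True
    then obtain u v where uv: "u \<in> V" "v \<in> V" "u \<noteq> v" "deg E u < r" "deg E v < r" "{u, v} \<notin> E"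
      by blast
    have "deg (insert {u, v} E) w \<le> r" for w
      using uv E(3)[of w] by (auto simp: deg_insert[OF fin])
    then show ?thesis
      using uv E fin by (intro exI[of _ "insert {u, v} E"]) auto
  next
    case False
    \<comment> \<open>The total deficiency from \<open>r\<close> is at least 2, so either one vertex
      lacks two edges or two distinct vertices lack one each.\<close>
    have sum: "(\<Sum>v\<in>V. deg E v) + 2 \<le> (\<Sum>v\<in>V. r)"
      using Suc.prems E handshake[OF V E(1)] by (simp add: mult.commute)
    obtain u v where uv: "u \<in> V" "v \<in> V" "deg E u < r" "deg E v < r"
      "u = v \<and> deg E u + 2 \<le> r \<or> u \<noteq> v"
    proof -
      have "\<exists>u\<in>V. deg E u < r"
      proof (rule ccontr)
        assume "\<not> ?thesis"
        then have "(\<Sum>v\<in>V. r) \<le> (\<Sum>v\<in>V. deg E v)" by (intro sum_mono) (auto simp: not_less)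
        with sum show False by linarith
      qed
      then obtain u where u: "u \<in> V" "deg E u < r" by blast
      show ?thesis
      proof (cases "deg E u + 2 \<le> r")
        case True
        with u show ?thesis by (intro that[of u u]) auto
      next
        case False
        have "\<exists>v\<in>V - {u}. deg E v < r"
        proof (rule ccontr)
          assume "\<not> ?thesis"
          then have "(\<Sum>v\<in>V - {u}. r) \<le> (\<Sum>v\<in>V - {u}. deg E v)"
            by (intro sum_mono) (auto simp: not_less)
          moreover have "(\<Sum>v\<in>V. r) = r + (\<Sum>v\<in>V - {u}. r)"
            using u V by (rule_tac sum.remove) auto
          moreover have "(\<Sum>v\<in>V. deg E v) = deg E u + (\<Sum>v\<in>V - {u}. deg E v)"
            using u V by (rule_tac sum.remove) auto
          ultimately show False using sum False by linarith
        qed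
        with u show ?thesis by (auto intro: that)
      qed
    qed
    have "\<not> V \<subseteq> insert u (nbrs E u)"
    proof
      assume "V \<subseteq> insert u (nbrs E u)"
      then have "card V \<le> card (insert u (nbrs E u))" using finN by (intro card_mono) auto
      also have "\<dots> \<le> Suc (deg E u)" using card_nbrs[OF E(1)] finN
        by (simp add: card_insert_if)
      finally show False using uv r by linarith
    qed
    then obtain x where x: "x \<in> V" "x \<noteq> u" "{u, x} \<notin> E" by (auto simp: nbrs_def)
    have xv: "x \<noteq> v" using False x uv by auto
    have degx: "deg E x = r"
      using False x uv E(3)[of x] by (metis le_neq_implies_less)
    \<comment> \<open>The vertices forbidden for \<open>y\<close>, apart from \<open>u\<close>,
      which is not a neighbour of \<open>x\<close> anyway. If \<open>u\<close> and \<open>v\<close>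
      differ, they are adjacent in this case, so leaving out \<open>u\<close> makes up for inserting
      \<open>v\<close>. Hence \<open>?S\<close> has fewer than \<open>r\<close> elements, too few to
      cover the \<open>r\<close> neighbours of \<open>x\<close>.\<close>
    let ?S = "insert v (nbrs E v) - {u}"
    have "card ?S < r"
    proof (cases "u = v")
      case True
      then have "card ?S \<le> card (nbrs E v)" using finN by (intro card_mono) auto
      then show ?thesis using uv card_nbrs[OF E(1), of v] by linarith
    next
      case neq: False
      then have "{u, v} \<in> E" using False uv by blast
      then have "u \<in> nbrs E v" using neq by (auto simp: nbrs_def insert_commute)
      moreover have "v \<notin> nbrs E v" by (simp add: nbrs_def)
      ultimately have "card ?S = card (nbrs E v)" using finN[of v] by simp
      then show ?thesis using uv card_nbrs[OF E(1), of v] by linarith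
    qed
    then have "\<not> nbrs E x \<subseteq> ?S"
      using card_mono[of ?S "nbrs E x"] finN[of v] card_nbrs[OF E(1), of x] degx by auto
    then obtain y where y: "y \<in> nbrs E x" "y \<notin> ?S" by blast
    have xy: "{x, y} \<in> E" "x \<noteq> y" using y by (auto simp: nbrs_def)
    have yu: "y \<noteq> u" using xy x by (auto simp: insert_commute)
    have yv: "y \<noteq> v" "{v, y} \<notin> E" using y yu by (auto simp: nbrs_def)
    have yV: "y \<in> V" using y nbrs_subset[OF E(1)] by blast
    define F where "F = insert {u, x} (insert {v, y} (E - {{x, y}}))"
    have n1: "{v, y} \<notin> E - {{x, y}}" using yv by blast
    have n2: "{u, x} \<notin> insert {v, y} (E - {{x, y}})"
      using x xv xy yu by (auto simp: doubleton_eq_iff)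
    \<comment> \<open>\<open>x\<close> and \<open>y\<close> lose one edge and gain one; only
      \<open>u\<close> and \<open>v\<close> gain, two edges at once if they coincide.\<close>
    have "deg F w \<le> r" for w
    proof -
      have "deg F w = deg (E - {{x, y}}) w + of_bool (w \<in> {v, y}) + of_bool (w \<in> {u, x})"
        unfolding F_def using n1 n2 fin by (simp add: deg_insert)
      moreover have "deg (E - {{x, y}}) w + of_bool (w \<in> {x, y}) = deg E w"
        using fin xy by (intro deg_remove) auto
      ultimately show ?thesis
        using x xy xv yu yv uv E(3)[of w] by (auto split: if_splits)
    qed
    moreover have "card F = Suc m"
    proof -
      have "Suc (card (E - {{x, y}})) = m" using xy fin E(2) by (metis card_Suc_Diff1)
      then show ?thesis using n1 n2 fin by (simp add: F_def)
    qed
    moreover have "F \<subseteq> pairs V"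
      unfolding F_def using E x xy xv yu yv uv yV by auto
    ultimately show ?thesis by blast
  qed
qed

section \<open>The condition on pairs of degrees and its bounds on the number of edges\<close>

text \<open>Deleting the edge \<open>{a, b}\<close> costs 2 on the right for this pair, but it also
  lowers both degrees by one. This allows extremal graphs to be trimmed to an exact size.\<close>

lemma pair_degrees_le_subset:
  assumes "finite E" "F \<subseteq> E" "pair_degrees_le t V E"
  shows "pair_degrees_le t V F"
  unfolding pair_degrees_le_def
proof (intro ballI impI)
  fix a b assume ab: "a \<in> V" "b \<in> V" "a \<noteq> b"
  have le: "deg E a + deg E b \<le> t + 2 * of_bool ({a, b} \<in> E)"
    using assms ab by (auto simp: pair_degrees_le_def)
  have mono: "deg F a \<le> deg E a" "deg F b \<le> deg E b"
    by (rule deg_mono[OF assms(1,2)])+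
  show "deg F a + deg F b \<le> t + 2 * of_bool ({a, b} \<in> F)"
  proof (cases "{a, b} \<in> E - F")
    case True
    then have "F \<subseteq> E - {{a, b}}" using assms by auto
    then have "deg F a \<le> deg (E - {{a, b}}) a" "deg F b \<le> deg (E - {{a, b}}) b"
      using assms(1) by (simp_all add: deg_mono)
    moreover have "deg (E - {{a, b}}) a + 1 = deg E a" "deg (E - {{a, b}}) b + 1 = deg E b"
      using deg_remove[OF assms(1), of "{a, b}" a] deg_remove[OF assms(1), of "{a, b}" b] True
      by simp_all
    ultimately show ?thesis using le True by simp
  next
    case False
    then show ?thesis using le mono assms(2) by (cases "{a, b} \<in> E") auto
  qed
qed

text \<open>Sum the condition for \<open>x\<close> over all other vertices. Of the term
  \<open>3 * deg E x\<close>, two parts come from the edges at \<open>x\<close> on the right-hand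
  side, and one from the degree of \<open>x\<close>, missing in the handshake sum.\<close>

lemma pair_degrees_le_sum:
  assumes V: "finite V" and E: "E \<subseteq> pairs V" and "pair_degrees_le t V E" and x: "x \<in> V"
  shows "2 * card E + (card V - 1) * deg E x \<le> (card V - 1) * t + 3 * deg E x"
proof -
  let ?W = "V - {x}"
  have W: "finite ?W" "card ?W = card V - 1" using V x by auto
  have "(\<Sum>y\<in>?W. deg E x + deg E y) \<le> (\<Sum>y\<in>?W. t + 2 * of_bool ({x, y} \<in> E))"
  proof (rule sum_mono)
    fix y assume "y \<in> ?W"
    then have "y \<in> V" "x \<noteq> y" by auto
    then show "deg E x + deg E y \<le> t + 2 * of_bool ({x, y} \<in> E)"
      using assms(3) x unfolding pair_degrees_le_def by metis
  qed
  also have "\<dots> = (card V - 1) * t + 2 * card (?W \<inter> {y. {x, y} \<in> E})"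
    using W by (simp add: sum.distrib sum_distrib_left[symmetric])
  also have "?W \<inter> {y. {x, y} \<in> E} = nbrs E x"
    using nbrs_subset[OF E, of x] by (auto simp: nbrs_def)
  finally have "(card V - 1) * deg E x + (\<Sum>y\<in>?W. deg E y) \<le> (card V - 1) * t + 2 * deg E x"
    using W by (simp add: sum.distrib card_nbrs[OF E])
  moreover have "2 * card E = deg E x + (\<Sum>y\<in>?W. deg E y)"
    using handshake[OF V E] sum.remove[OF V x, of "deg E"] by simp
  ultimately show ?thesis by linarith
qed

lemma card_le_if_pair_degrees_le_odd:
  assumes V: "finite V" and E: "E \<subseteq> pairs V" and le: "pair_degrees_le (2 * b + 1) V E"
    and n: "card V \<ge> b + 5"
  shows "2 * card E \<le> b * card V + b + 2"
proof (cases "\<exists>x\<in>V. deg E x > b + 1")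
  case True
  then obtain x where x: "x \<in> V" "deg E x > b + 1" by blast
  obtain s where s: "deg E x = b + 2 + s" using x less_iff_Suc_add by auto
  obtain p where p: "card V = b + 5 + p" using n le_Suc_ex by blast
  have "2 * card E + (b + 4 + p) * (b + 2 + s) \<le> (b + 4 + p) * (2 * b + 1) + 3 * (b + 2 + s)"
  proof -
    have "card V - 1 = b + 4 + p" using p by simp
    then show ?thesis using pair_degrees_le_sum[OF V E le x(1)] unfolding s by simp
  qed
  \<comment> \<open>Expanded, the inequality is 2|E| + (b + 1)s + p(s + 1) \<le> b|V| + b +
    2.\<close>
  then show ?thesis unfolding p by (simp add: algebra_simps)
next
  case False
  let ?H = "{v \<in> V. deg E v = b + 1}"
  have H: "card ?H \<le> b + 2"
  proof (cases "?H = {}")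
    case True
    then show ?thesis by (metis card.empty le0)
  next
    case False
    then obtain x where x: "x \<in> V" "deg E x = b + 1" by blast
    \<comment> \<open>Nonadjacent members of \<open>?H\<close> would have degree sum 2b + 2, one too
      many. So \<open>?H\<close> lies in the closed neighbourhood of \<open>x\<close>, which has b +
      2 elements.\<close>
    have "y \<in> insert x (nbrs E x)" if y: "y \<in> ?H" for y
    proof (rule ccontr)
      assume "y \<notin> insert x (nbrs E x)"
      then have "y \<noteq> x" "{x, y} \<notin> E" by (auto simp: nbrs_def)
      then have "deg E x + deg E y \<le> 2 * b + 1"
        using le x y unfolding pair_degrees_le_def by fastforce
      with x y show False by simp
    qed
    then have "card ?H \<le> card (insert x (nbrs E x))"
      using nbrs_subset[OF E] V finite_subset by (intro card_mono) blast+
    also have "\<dots> \<le> b + 2" using card_nbrs[OF E, of x] x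
      using card_insert_le_m1[of "b + 2" "nbrs E x" x] by simp
    finally show ?thesis .
  qed
  have "2 * card E = (\<Sum>v\<in>V. deg E v)" using handshake[OF V E] by simp
  also have "\<dots> \<le> (\<Sum>v\<in>V. b + of_bool (deg E v = b + 1))"
    using False by (intro sum_mono) (auto simp: not_less le_Suc_eq)
  also have "\<dots> = b * card V + card ?H"
    using V by (simp add: sum.distrib Int_def)
  finally show ?thesis using H by simp
qed

lemma card_le_if_pair_degrees_le_even:
  assumes V: "finite V" and E: "E \<subseteq> pairs V" and le: "pair_degrees_le (2 * a) V E"
    and a: "a > 0" and n: "card V \<ge> 2 * a + 3 + a mod 2"
  shows "2 * card E \<le> a * card V"
proof (cases "\<exists>x\<in>V. deg E x > a")
  case True
  then obtain x where x: "x \<in> V" "deg E x > a" by blast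
  obtain s where s: "deg E x = a + 1 + s" using x less_iff_Suc_add by auto
  obtain p where p: "card V = 2 * a + 3 + p" using n le_Suc_ex by (metis add_leD1)
  have sum: "2 * card E + (2 * a + 2 + p) * (a + 1 + s)
      \<le> (2 * a + 2 + p) * (2 * a) + 3 * (a + 1 + s)"
  proof -
    have "card V - 1 = 2 * a + 2 + p" using p by simp
    then show ?thesis using pair_degrees_le_sum[OF V E le x(1)] unfolding s by simp
  qed
  have "2 * card E + p + 2 * a * s + p * s \<le> a * card V + 1 + s"
    using sum unfolding p by (simp add: algebra_simps)
  moreover have "2 * s \<le> 2 * a * s" using a by simp
  ultimately have bound: "2 * card E + p + s \<le> a * card V + 1" by linarith
  \<comment> \<open>The surplus 1 is absorbed by \<open>p\<close> if \<open>p\<close> is positive.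
    If \<open>p = 0\<close>, the term \<open>a mod 2\<close> in the hypothesis on
    \<open>card V\<close> forces \<open>a\<close> to be even, and both sides of the desired
    inequality are even.\<close>
  show ?thesis
  proof (cases "p = 0")
    case True
    then have "even a" using n p by (auto simp: even_iff_mod_2_eq_zero)
    then have "even (a * card V)" by simp
    with bound show ?thesis by presburger
  qed (use bound in linarith)
next
  case False
  have "2 * card E = (\<Sum>v\<in>V. deg E v)" using handshake[OF V E] by simp
  also have "\<dots> \<le> (\<Sum>v\<in>V. a)" using False by (intro sum_mono) (auto simp: not_less)
  finally show ?thesis by (simp add: mult.commute)
qed

section \<open>Extremal constructions\<close>

lemma exists_pair_degrees_le_even:
  assumes V: "finite V" and "a < card V" "2 * m \<le> a * card V"
  shows "\<exists>E. E \<subseteq> pairs V \<and> card E = m \<and> pair_degrees_le (2 * a) V E"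
proof -
  obtain E where E: "E \<subseteq> pairs V" "card E = m" "\<And>v. deg E v \<le> a"
    using exists_graph_bounded_degree[OF assms] by blast
  have "deg E u + deg E v \<le> 2 * a" for u v using E(3)[of u] E(3)[of v] by linarith
  then show ?thesis using E(1,2)
    by (intro exI[of _ E]) (simp add: pair_degrees_le_def trans_le_add1)
qed

text \<open>In a clique on a + 2 vertices the degree sum 2a + 2 is allowed because the vertices are
  adjacent. With degrees at most \<open>a\<close> outside, a mixed pair has sum at most 2a + 1, so
  no edges between the two parts are needed.\<close>

lemma exists_pair_degrees_le_odd:
  assumes V: "finite V" and n: "2 * a + 3 \<le> card V" and m: "2 * m \<le> a * card V + a + 2"
  shows "\<exists>E. E \<subseteq> pairs V \<and> card E = m \<and> pair_degrees_le (2 * a + 1) V E"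
proof -
  obtain A where A: "A \<subseteq> V" "card A = a + 2"
    using n obtain_subset_with_card_n[of "a + 2" V] by auto
  let ?B = "V - A"
  have finA: "finite A" using A V finite_subset by blast
  have B: "finite ?B" "card ?B = card V - (a + 2)" using A V finA by (auto simp: card_Diff_subset)
  define q where "q = (a * card ?B) div 2"
  \<comment> \<open>\<open>card V\<close> is at least 2a + 3, which leaves at least a + 1 vertices
    outside the clique.\<close>
  have "a < card ?B" "2 * q \<le> a * card ?B" using B n by (auto simp: q_def)
  then obtain F where F: "F \<subseteq> pairs ?B" "card F = q" "\<And>v. deg F v \<le> a"
    using exists_graph_bounded_degree[OF B(1)] by blast
  have fin: "finite F" "finite (pairs A)" using F B finA finite_pairs finite_subset by blast+
  define G where "G = pairs A \<union> F"
  have G: "G \<subseteq> pairs V" using F A pairs_mono[of A V] pairs_mono[of ?B V] by (auto simp: G_def)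
  have "pairs A \<inter> F = {}"
  proof -
    have "pairs A \<inter> pairs ?B = {}" by (fastforce elim: pairsE)
    then show ?thesis using F by blast
  qed
  then have "card G = card (pairs A) + q"
    using fin F by (simp add: G_def card_Un_disjoint)
  moreover have "2 * card (pairs A) = (a + 2) * (a + 1)"
    using card_pairs[OF finA] A by (simp add: choose_two)
  moreover have "a * card ?B + a * (a + 2) = a * card V"
  proof -
    have "card V = card ?B + (a + 2)" using B n by simp
    then show ?thesis by (simp only: distrib_left)
  qed
  moreover have "2 * q + 1 \<ge> a * card ?B" by (simp add: q_def)
  \<comment> \<open>Together 2|G| + 1 \<ge> a|V| + a + 2 \<ge> 2m; the 1 lost by rounding in
    \<open>q\<close> does not matter for integers.\<close>
  ultimately have "m \<le> card G" using m by (simp add: algebra_simps)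
  then obtain E where E: "E \<subseteq> G" "card E = m" by (meson obtain_subset_with_card_n)
  have degA: "deg G v \<le> a + 1" if "v \<in> A" for v
  proof -
    have "nbrs (pairs A) v = A - {v}" using that by (auto simp: nbrs_def)
    then have "deg (pairs A) v = a + 1" using card_nbrs[of "pairs A" A v] A finA that by simp
    moreover have "deg F v = 0" using F that by (intro deg_eq_0[of _ ?B]) auto
    ultimately show ?thesis using deg_Un[OF fin(2,1), of v] by (simp add: G_def)
  qed
  have degB: "deg G v \<le> a" if "v \<in> ?B" for v
  proof -
    have "deg (pairs A) v = 0" using that by (intro deg_eq_0[of _ A]) auto
    then show ?thesis using deg_Un[OF fin(2,1), of v] F(3)[of v] by (simp add: G_def)
  qed
  have "pair_degrees_le (2 * a + 1) V G"
    unfolding pair_degrees_le_def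
  proof (intro ballI impI)
    fix u v assume uv: "u \<in> V" "v \<in> V" "u \<noteq> v"
    show "deg G u + deg G v \<le> 2 * a + 1 + 2 * of_bool ({u, v} \<in> G)"
    proof (cases "u \<in> A \<and> v \<in> A")
      case True
      then have "{u, v} \<in> G" using uv by (simp add: G_def)
      then show ?thesis using degA[of u] degA[of v] True by simp
    next
      case False
      then show ?thesis using degA[of u] degA[of v] degB[of u] degB[of v] uv
        by (cases "u \<in> A"; cases "v \<in> A") auto
    qed
  qed
  moreover have "finite G" using fin by (simp add: G_def)
  ultimately have "pair_degrees_le (2 * a + 1) V E" using E pair_degrees_le_subset by blast
  then show ?thesis using E G by blast
qed

section \<open>Translation to tuple domination in the Kneser graph\<close>

lemma pverts_kneser_graph_2: "pverts (kneser_graph n 2) = pairs {1..n}"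
  by (simp add: kneser_graph_def pairs_def)

text \<open>An element of \<open>D\<close> is missed exactly if it shares one point with
  \<open>{a, b}\<close>. The degree sum counts those once, but it also counts \<open>{a, b}\<close>
  itself twice if it is in \<open>D\<close>.\<close>

lemma card_closed_neighbourhood_kneser_graph:
  assumes D: "D \<subseteq> pairs {1..n}" and ab: "{a, b} \<in> pairs {1..n}"
  shows "card (closed_neighbourhood (kneser_graph n 2) {a, b} \<inter> D) + deg D a + deg D b
    = card D + 2 * of_bool ({a, b} \<in> D)"
proof -
  let ?a = "{e \<in> D. a \<in> e}" and ?b = "{e \<in> D. b \<in> e}" and ?v = "D \<inter> {{a, b}}"
  have fin: "finite D" using D finite_pairs finite_subset by blast
  have neq: "a \<noteq> b" using ab by simp
  have v: "(a \<in> e \<and> b \<in> e) \<longleftrightarrow> e = {a, b}" if "e \<in> D" for e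
  proof -
    have "e \<in> pairs {1..n}" using that D by blast
    then obtain c d where "e = {c, d}" by (rule pairsE)
    then show ?thesis using neq by auto
  qed
  have int: "?a \<inter> ?b = ?v" using v by auto
  have "closed_neighbourhood (kneser_graph n 2) {a, b} \<inter> D = (D - (?a \<union> ?b)) \<union> ?v"
    using D ab by (auto simp: closed_neighbourhood_def kneser_graph_def pairs_def)
  moreover have "card ((D - (?a \<union> ?b)) \<union> ?v) = card (D - (?a \<union> ?b)) + card ?v"
    using fin by (intro card_Un_disjoint) auto
  moreover have "card (D - (?a \<union> ?b)) + card (?a \<union> ?b) = card D"
    using fin card_mono[of D "?a \<union> ?b"] by (subst card_Diff_subset) auto
  moreover have "deg D a + deg D b = card (?a \<union> ?b) + card ?v"
    unfolding deg_def using card_Un_Int[of ?a ?b] fin int by simp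
  moreover have "card ?v = of_bool ({a, b} \<in> D)" by (cases "{a, b} \<in> D") auto
  ultimately show ?thesis by simp
qed

text \<open>Writing the size as k + t avoids truncated subtraction and yields a condition in which
  \<open>k\<close> no longer occurs.\<close>

lemma k_tuple_dominating_set_kneser_graph_iff:
  assumes "card D = k + t"
  shows "k_tuple_dominating_set k (kneser_graph n 2) D \<longleftrightarrow>
    D \<subseteq> pairs {1..n} \<and> pair_degrees_le t {1..n} D"
proof -
  have "(\<forall>v\<in>pairs {1..n}. k \<le> card (closed_neighbourhood (kneser_graph n 2) v \<inter> D)) \<longleftrightarrow>
      pair_degrees_le t {1..n} D" (is "?L \<longleftrightarrow> ?R") if D: "D \<subseteq> pairs {1..n}"
  proof -
    have iff: "k \<le> card (closed_neighbourhood (kneser_graph n 2) {a, b} \<inter> D) \<longleftrightarrow>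
        deg D a + deg D b \<le> t + 2 * of_bool ({a, b} \<in> D)" if "{a, b} \<in> pairs {1..n}" for a b
      using card_closed_neighbourhood_kneser_graph[OF D that] assms by linarith
    show ?thesis
    proof
      assume L: ?L
      show ?R unfolding pair_degrees_le_def
      proof (intro ballI impI)
        fix a b assume "a \<in> {1..n}" "b \<in> {1..n}" "a \<noteq> b"
        then have "{a, b} \<in> pairs {1..n}" by simp
        then show "deg D a + deg D b \<le> t + 2 * of_bool ({a, b} \<in> D)" using L iff by blast
      qed
    next
      assume R: ?R
      show ?L
      proof
        fix v assume v: "v \<in> pairs {1..n}"
        then obtain a b where ab: "v = {a, b}" "a \<in> {1..n}" "b \<in> {1..n}" "a \<noteq> b" by (rule pairsE)
        then show "k \<le> card (closed_neighbourhood (kneser_graph n 2) v \<inter> D)"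
          using R iff[of a b] v unfolding pair_degrees_le_def by blast
      qed
    qed
  qed
  then show ?thesis unfolding k_tuple_dominating_set_def pverts_kneser_graph_2 by blast
qed

text \<open>Excluding the single size \<open>m\<close> suffices: domination passes to supersets, so
  a smaller dominating set could be enlarged to exactly \<open>m\<close> vertices.\<close>

lemma k_tuple_domination_number_eqI:
  assumes fin: "finite (pverts G)"
    and ex: "k_tuple_dominating_set k G D" "card D = Suc m"
    and none: "\<And>D. k_tuple_dominating_set k G D \<Longrightarrow> card D \<noteq> m"
  shows "k_tuple_domination_number k G = enat (Suc m)"
  unfolding k_tuple_domination_number_eq_enat_iff
proof (intro conjI exI allI impI)
  fix C assume C: "k_tuple_dominating_set k G C"
  show "Suc m \<le> card C"
  proof (rule ccontr)
    assume "\<not> ?thesis"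
    then have "card C \<le> m" by simp
    moreover have "m \<le> card (pverts G)"
      using ex card_mono[OF fin, of D] by (auto simp: k_tuple_dominating_set_def)
    moreover have sub: "C \<subseteq> pverts G" using C by (simp add: k_tuple_dominating_set_def)
    ultimately obtain B where B: "C \<subseteq> B" "B \<subseteq> pverts G" "card B = m"
      using exists_subset_between[OF _ _ _ fin] by blast
    have "finite B" using B fin finite_subset by blast
    then have "card (closed_neighbourhood G v \<inter> C) \<le> card (closed_neighbourhood G v \<inter> B)" for v
      using B by (intro card_mono) auto
    then have "k_tuple_dominating_set k G B"
      using C B unfolding k_tuple_dominating_set_def by (meson order_trans)
    with none B show False by blast
  qed
qed (use ex in auto)

lemma k_tuple_domination_number_kneser_graph_eqI:
  assumes "D \<subseteq> pairs {1..n}" "card D = Suc (k + t)" "pair_degrees_le (Suc t) {1..n} D"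
    and "\<And>E. E \<subseteq> pairs {1..n} \<Longrightarrow> pair_degrees_le t {1..n} E \<Longrightarrow> card E \<noteq> k + t"
  shows "k_tuple_domination_number k (kneser_graph n 2) = enat (Suc (k + t))"
proof (rule k_tuple_domination_number_eqI)
  show "finite (pverts (kneser_graph n 2))" by (simp add: pverts_kneser_graph_2 finite_pairs)
  show "k_tuple_dominating_set k (kneser_graph n 2) D"
    using assms by (subst k_tuple_dominating_set_kneser_graph_iff[where t = "Suc t"]) auto
  show "card E \<noteq> k + t" if "k_tuple_dominating_set k (kneser_graph n 2) E" for E
    using assms that k_tuple_dominating_set_kneser_graph_iff by blast
qed (fact assms)

theorem theorem28:
  fixes \<alpha> n k :: nat
  assumes "\<alpha> \<ge> 2" and "n \<ge> 2 * \<alpha> + 3 + \<alpha> mod 2" and "k > 0"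
  shows "(2 / real \<alpha> * real k + 4 \<le> real n \<and> real n < 2 / (real \<alpha> - 1) * real k + 3 \<longrightarrow>
      k_tuple_domination_number k (kneser_graph n 2) = enat (k + 2 * \<alpha>)) \<and>
    (int n = \<lceil>2 / real \<alpha> * real k\<rceil> + 3 \<longrightarrow>
      k_tuple_domination_number k (kneser_graph n 2) = enat (k + 2 * \<alpha> + 1))"
proof (intro conjI impI)
  assume A: "2 / real \<alpha> * real k + 4 \<le> real n \<and> real n < 2 / (real \<alpha> - 1) * real k + 3"
  obtain b where b: "\<alpha> = Suc b" "b > 0" using assms(1) by (cases \<alpha>) auto
  have "real (2 * k + 4 * \<alpha>) \<le> real (\<alpha> * n)" using A b(1) by (simp add: field_simps)
  then have upper: "2 * (k + 2 * \<alpha>) \<le> \<alpha> * card {1..n}"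
    unfolding of_nat_le_iff by simp
  have "real (b * n) < real (2 * k + 3 * b)" using A b by (simp add: field_simps)
  then have lower: "b * n < 2 * k + 3 * b" unfolding of_nat_less_iff .
  have "\<alpha> < card {1..n}" using assms by simp
  from exists_pair_degrees_le_even[OF finite_atLeastAtMost this upper]
  obtain D where D: "D \<subseteq> pairs {1..n}" "card D = k + 2 * \<alpha>" "pair_degrees_le (2 * \<alpha>) {1..n} D"
    by blast
  have "k_tuple_domination_number k (kneser_graph n 2) = enat (Suc (k + (2 * b + 1)))"
  proof (rule k_tuple_domination_number_kneser_graph_eqI)
    \<comment> \<open>For |E| = k + 2b + 1 the edge bound would give 2k + 3b \<le> bn, contrary to
      \<open>lower\<close>.\<close>
    show "card E \<noteq> k + (2 * b + 1)"
      if "E \<subseteq> pairs {1..n}" "pair_degrees_le (2 * b + 1) {1..n} E" for E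
      using card_le_if_pair_degrees_le_odd[OF _ that] lower assms b by auto
  qed (use D b in \<open>simp_all add: numeral_2_eq_2\<close>)
  then show "k_tuple_domination_number k (kneser_graph n 2) = enat (k + 2 * \<alpha>)"
    using b by simp
next
  assume A: "int n = \<lceil>2 / real \<alpha> * real k\<rceil> + 3"
  have "real n - 3 = of_int \<lceil>2 / real \<alpha> * real k\<rceil>" using A by linarith
  then have "2 / real \<alpha> * real k \<le> real n - 3" "real n - 3 < 2 / real \<alpha> * real k + 1"
    using ceiling_correct[of "2 / real \<alpha> * real k"] by linarith+
  \<comment> \<open>With denominators cleared, the ceiling says 2k + 3\<alpha> \<le> \<alpha>n < 2k
    + 4\<alpha>. The left part makes room for k + 2\<alpha> + 1 edges in the construction; the right
    part rules out k + 2\<alpha> edges by 2|E| \<le> \<alpha>n.\<close>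
  then have "real (2 * k + 3 * \<alpha>) \<le> real (\<alpha> * n)" "real (\<alpha> * n) < real (2 * k + 4 * \<alpha>)"
    using assms(1) by (simp_all add: field_simps)
  then have upper: "2 * (k + 2 * \<alpha> + 1) \<le> \<alpha> * card {1..n} + \<alpha> + 2"
    and lower: "\<alpha> * n < 2 * (k + 2 * \<alpha>)" by (simp_all only: of_nat_le_iff of_nat_less_iff) auto
  have "2 * \<alpha> + 3 \<le> card {1..n}" using assms by simp
  from exists_pair_degrees_le_odd[OF finite_atLeastAtMost this upper]
  obtain D where D: "D \<subseteq> pairs {1..n}" "card D = k + 2 * \<alpha> + 1"
    "pair_degrees_le (2 * \<alpha> + 1) {1..n} D" by blast
  have "k_tuple_domination_number k (kneser_graph n 2) = enat (Suc (k + 2 * \<alpha>))"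
  proof (rule k_tuple_domination_number_kneser_graph_eqI)
    show "card E \<noteq> k + 2 * \<alpha>"
      if "E \<subseteq> pairs {1..n}" "pair_degrees_le (2 * \<alpha>) {1..n} E" for E
      using card_le_if_pair_degrees_le_even[OF _ that] lower assms by auto
  qed (use D in simp_all)
  then show "k_tuple_domination_number k (kneser_graph n 2) = enat (k + 2 * \<alpha> + 1)" by simp
qed

end
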